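(* Let $\{\varphi_i\}_{i=1}^\infty$ be a Riesz basis for a Hilbert space $\mathbb{H}$ and let $\{\psi_i\}_{i=1}^\infty$ be a frame for $\mathbb{H}$. If $\{\varphi_i\}_{i=1}^\infty$ and $\{\psi_i\}_{i=1}^\infty$ are woven, then $\{\psi_i\}_{i=1}^\infty$ is a Riesz basis for $\mathbb{H}$.
   Context: A family $\{f_i\}_{i\in I}$ in $\mathbb{H}$ is a frame for $\mathbb H$ with lower and upper frame bounds $A,B$ if $0<A\le B<\infty$ and $A\|x\|^2\le \sum_{i\in I}|\langle x,f_i\rangle|^2\le B\|x\|^2$ for all $x\in\mathbb{H}$. It is a Riesz sequence with Riesz bounds $A,B$ if $0<A\le B<\infty$ and $A\sum_{i}|c_i|^2\le\|\sum_{i}c_if_i\|^2\le B\sum_{i}|c_i|^2$ for all $\{c_i\}\in\ell^2(I)$; it is a Riesz basis for $\mathbb{H}$ if in addition it is complete in $\mathbb{H}$ (its closed span is $\mathbb{H}$). Two frames $\{\varphi_i\}_{i=1}^\infty$, $\{\psi_i\}_{i=1}^\infty$ for $\mathbb{H}$ are woven if there are universal constants $0<A\le B<\infty$ such that for every $\sigma\subset\mathbb{N}$ (with $\sigma^c=\mathbb N\setminus\sigma$) the indexed family $\{\varphi_i\}_{i\in\sigma}\cup\{\psi_i\}_{i\in\sigma^c}$ is a frame for $\mathbb{H}$ with lower and upper frame bounds $A$ and $B$. *)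

theory Defs
  imports "HOL-Analysis.Analysis"
begin

text \<open>
  Hilbert spaces may be real or complex, so everything is stated over a scalar field of the
  following class. By Gelfand--Mazur, a field with a multiplicative real norm is isometrically
  the reals or the complex numbers, and \<open>mult_scalar_conj\<close> forces \<open>scalar_conj\<close> to be the
  identity or complex conjugation, respectively. So \<open>real\<close> and \<open>complex\<close> are, up to
  isomorphism, the only instances.
\<close>

class real_or_complex = real_normed_field +
  fixes scalar_conj :: "'a \<Rightarrow> 'a"
  assumes scalar_conj_add: "scalar_conj (x + y) = scalar_conj x + scalar_conj y"
    and scalar_conj_mult: "scalar_conj (x * y) = scalar_conj x * scalar_conj y"
    and mult_scalar_conj: "x * scalar_conj x = (norm x)\<^sup>2 *\<^sub>R 1"

instantiation real :: real_or_complex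
begin
definition scalar_conj_real :: "real \<Rightarrow> real" where "scalar_conj_real x = x"
instance
  by standard (simp_all add: scalar_conj_real_def power2_eq_square)
end

instantiation complex :: real_or_complex
begin
definition scalar_conj_complex :: "complex \<Rightarrow> complex" where "scalar_conj_complex x = cnj x"
instance
proof
  fix x y :: complex
  show "x * scalar_conj x = (norm x)\<^sup>2 *\<^sub>R 1"
    unfolding scalar_conj_complex_def scaleR_conv_of_real complex_norm_square by simp
qed (simp_all add: scalar_conj_complex_def)
end

text \<open>
  The carrier is a whole type of class \<open>banach\<close>, which supplies the topology, the norm and its
  completeness; \<open>ip_self\<close> says that this norm is the one induced by the inner product (and thereby
  that the inner product is positive definite). The inner product is linear in its first argument.
\<close>

locale hilbert_space = vector_space smul
  for smul :: "'k::real_or_complex \<Rightarrow> 'a::banach \<Rightarrow> 'a" +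
  fixes ip :: "'a \<Rightarrow> 'a \<Rightarrow> 'k"
  assumes smul_of_real: "smul (of_real r) x = r *\<^sub>R x"
    and ip_add_left: "ip (x + y) z = ip x z + ip y z"
    and ip_smul_left: "ip (smul c x) y = c * ip x y"
    and ip_commute: "ip y x = scalar_conj (ip x y)"
    and ip_self: "ip x x = of_real ((norm x)\<^sup>2)"

lemma hilbert_space_real:
  "hilbert_space (scaleR :: real \<Rightarrow> 'a::{real_inner,banach} \<Rightarrow> 'a) inner"
proof unfold_locales
  show "inner y x = scalar_conj (inner x y)" for x y :: 'a
    by (simp add: scalar_conj_real_def inner_commute)
qed (simp_all add: scaleR_add_right scaleR_add_left inner_add_left dot_square_norm)

lemma hilbert_space_complex:
  "hilbert_space ((*) :: complex \<Rightarrow> complex \<Rightarrow> complex) (\<lambda>x y. x * cnj y)"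
proof unfold_locales
  show "x * cnj x = of_real ((norm x)\<^sup>2)" for x
    unfolding complex_norm_square ..
qed (simp_all add: distrib_left distrib_right scalar_conj_complex_def scaleR_conv_of_real)

text \<open>
  Sums over an index set are unordered (unconditional) sums. As \<open>infsum\<close> is \<open>0\<close> for divergent
  sums, convergence is required explicitly throughout. In \<open>riesz_sequence_bounds\<close> this is no
  restriction on the meaning of the series: if it converges in some fixed order for every
  square-summable \<open>c\<close>, then so do all its subseries, hence it converges unconditionally.
\<close>

definition frame_bounds ::
    "('a::real_normed_vector \<Rightarrow> 'a \<Rightarrow> 'k::real_normed_field) \<Rightarrow> 'i set \<Rightarrow> ('i \<Rightarrow> 'a)
      \<Rightarrow> real \<Rightarrow> real \<Rightarrow> bool" where
  "frame_bounds ip I f A B \<longleftrightarrow> 0 < A \<and> A \<le> B \<and>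
     (\<forall>x. (\<lambda>i. (norm (ip x (f i)))\<^sup>2) summable_on I \<and>
          A * (norm x)\<^sup>2 \<le> (\<Sum>\<^sub>\<infinity>i\<in>I. (norm (ip x (f i)))\<^sup>2) \<and>
          (\<Sum>\<^sub>\<infinity>i\<in>I. (norm (ip x (f i)))\<^sup>2) \<le> B * (norm x)\<^sup>2)"

definition is_frame ::
    "('a::real_normed_vector \<Rightarrow> 'a \<Rightarrow> 'k::real_normed_field) \<Rightarrow> 'i set \<Rightarrow> ('i \<Rightarrow> 'a) \<Rightarrow> bool" where
  "is_frame ip I f \<longleftrightarrow> (\<exists>A B. frame_bounds ip I f A B)"

definition riesz_sequence_bounds ::
    "('k::real_normed_field \<Rightarrow> 'a::real_normed_vector \<Rightarrow> 'a) \<Rightarrow> 'i set \<Rightarrow> ('i \<Rightarrow> 'a)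
      \<Rightarrow> real \<Rightarrow> real \<Rightarrow> bool" where
  "riesz_sequence_bounds smul I f A B \<longleftrightarrow> 0 < A \<and> A \<le> B \<and>
     (\<forall>c :: 'i \<Rightarrow> 'k. (\<lambda>i. (norm (c i))\<^sup>2) summable_on I \<longrightarrow>
          (\<lambda>i. smul (c i) (f i)) summable_on I \<and>
          A * (\<Sum>\<^sub>\<infinity>i\<in>I. (norm (c i))\<^sup>2) \<le> (norm (\<Sum>\<^sub>\<infinity>i\<in>I. smul (c i) (f i)))\<^sup>2 \<and>
          (norm (\<Sum>\<^sub>\<infinity>i\<in>I. smul (c i) (f i)))\<^sup>2 \<le> B * (\<Sum>\<^sub>\<infinity>i\<in>I. (norm (c i))\<^sup>2))"

definition riesz_sequence ::
    "('k::real_normed_field \<Rightarrow> 'a::real_normed_vector \<Rightarrow> 'a) \<Rightarrow> 'i set \<Rightarrow> ('i \<Rightarrow> 'a) \<Rightarrow> bool" where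
  "riesz_sequence smul I f \<longleftrightarrow> (\<exists>A B. riesz_sequence_bounds smul I f A B)"

definition riesz_basis ::
    "('k::real_normed_field \<Rightarrow> 'a::real_normed_vector \<Rightarrow> 'a) \<Rightarrow> 'i set \<Rightarrow> ('i \<Rightarrow> 'a) \<Rightarrow> bool" where
  "riesz_basis smul I f \<longleftrightarrow>
     riesz_sequence smul I f \<and> closure (module.span smul (f ` I)) = UNIV"

text \<open>
  The union of the families \<open>\<phi>\<^sub>i\<close> (\<open>i \<in> \<sigma>\<close>) and \<open>\<psi>\<^sub>i\<close> (\<open>i \<notin> \<sigma>\<close>) is a union of indexed
  families: it is again indexed by \<open>nat\<close>, and repeated vectors count with multiplicity.
\<close>

definition woven ::
    "('a::real_normed_vector \<Rightarrow> 'a \<Rightarrow> 'k::real_normed_field) \<Rightarrow> (nat \<Rightarrow> 'a) \<Rightarrow> (nat \<Rightarrow> 'a) \<Rightarrow> bool"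
  where
  "woven ip \<phi> \<psi> \<longleftrightarrow> is_frame ip UNIV \<phi> \<and> is_frame ip UNIV \<psi> \<and>
     (\<exists>A B. 0 < A \<and> A \<le> B \<and>
       (\<forall>\<sigma> :: nat set. frame_bounds ip UNIV (\<lambda>i. if i \<in> \<sigma> then \<phi> i else \<psi> i) A B))"

end

theory Submission imports Defs begin

text \<open>
  Swap \<open>\<phi>\<^sub>k\<close> for \<open>\<psi>\<^sub>k\<close> one index at a time. A Riesz basis \<open>\<phi>\<close> has a dual system \<open>u\<close>, with
  \<open>\<langle>u\<^sub>j, \<phi>\<^sub>i\<rangle> = \<delta>\<^sub>i\<^sub>j\<close>. The vector \<open>u\<^sub>k\<close> is orthogonal to every \<open>\<phi>\<^sub>i\<close> with \<open>i \<noteq> k\<close>. Since the family with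
  \<open>\<phi>\<^sub>k\<close> replaced by \<open>\<psi>\<^sub>k\<close> is a weaving, hence a frame, \<open>u\<^sub>k\<close> cannot also be orthogonal to \<open>\<psi>\<^sub>k\<close>.
  So \<open>u\<close> can be corrected, as in a Gauss elimination step, to a dual system of the new family
  (\<open>biorthogonal_exchange\<close>). By induction, for every finite \<open>F\<close> the weaving that takes \<open>\<psi>\<close> on \<open>F\<close>
  and \<open>\<phi>\<close> elsewhere has a dual system (\<open>finite_weaving_has_dual\<close>).

  A frame with a dual system satisfies the lower Riesz inequality for finite sums, with its lower
  frame bound as the constant (\<open>frame_synthesis_lower\<close>). For coefficients supported in \<open>F\<close>, only the
  \<open>\<psi>\<close> part of the weaving enters the sum. All weavings share the lower frame bound \<open>A\<close>, so the
  inequality for \<open>\<psi>\<close> holds with the constant \<open>A\<close> whatever the size of \<open>F\<close>, and it passes to infinite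
  sums. This uniformity is where the universality of the weaving bounds is used. The upper Riesz
  inequality and completeness hold for any frame.

  The dual system of \<open>\<phi>\<close> comes from the projection theorem: the lower Riesz bound keeps \<open>\<phi>\<^sub>k\<close> away
  from the closed span of the other vectors, and \<open>u\<^sub>k\<close> is a multiple of the component of \<open>\<phi>\<^sub>k\<close>
  orthogonal to that span.
\<close>

section \<open>Unconditional summability from a square bound\<close>

text \<open>
  The tails of the sum of \<open>g\<close> are small, so the bound makes the finite partial sums of \<open>f\<close> a Cauchy
  net. This gives convergence of \<open>\<Sum> c\<^sub>i f\<^sub>i\<close> for square-summable \<open>c\<close>, where absolute convergence
  may fail.
\<close>

lemma summable_on_of_square_bound:
  fixes f :: "'i \<Rightarrow> 'b::banach" and g :: "'i \<Rightarrow> real"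
  assumes g: "g summable_on I" "\<And>i. i \<in> I \<Longrightarrow> 0 \<le> g i"
    and bound: "\<And>F. finite F \<Longrightarrow> F \<subseteq> I \<Longrightarrow> (norm (sum f F))\<^sup>2 \<le> B * sum g F"
    and "0 < B"
  shows "f summable_on I"
proof -
  have "\<exists>P. eventually P (finite_subsets_at_top I) \<and> (\<forall>F G. P F \<and> P G \<longrightarrow> dist (sum f F) (sum f G) < e)"
    if "0 < e" for e
  proof -
    define \<epsilon> where "\<epsilon> = (e / 4)\<^sup>2 / B"
    have "0 < \<epsilon>" using \<open>0 < e\<close> \<open>0 < B\<close> by (simp add: \<epsilon>_def)
    then obtain T where T: "finite T" "T \<subseteq> I" "dist (sum g T) (infsum g I) \<le> \<epsilon>"
      using infsum_finite_approximation[OF g(1)] by metis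
    have close: "norm (sum f F - sum f T) \<le> e / 4" if F: "finite F" "F \<subseteq> I" "T \<subseteq> F" for F
    proof -
      have "sum g F \<le> infsum g I" using F g by (intro finite_sum_le_infsum) auto
      then have "sum g (F - T) \<le> \<epsilon>"
        using T F by (simp add: sum_diff dist_real_def abs_le_iff)
      have "(norm (sum f (F - T)))\<^sup>2 \<le> B * sum g (F - T)" using F by (intro bound) auto
      also have "\<dots> \<le> B * \<epsilon>" using \<open>sum g (F - T) \<le> \<epsilon>\<close> \<open>0 < B\<close> by simp
      also have "\<dots> = (e / 4)\<^sup>2" using \<open>0 < B\<close> by (simp add: \<epsilon>_def)
      finally have "norm (sum f (F - T)) \<le> e / 4" by (rule power2_le_imp_le) (use \<open>0 < e\<close> in simp)
      then show ?thesis using F by (simp add: sum_diff)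
    qed
    define P where "P F \<longleftrightarrow> finite F \<and> F \<subseteq> I \<and> T \<subseteq> F" for F
    have "eventually P (finite_subsets_at_top I)"
      unfolding eventually_finite_subsets_at_top P_def using T by blast
    moreover have "dist (sum f F) (sum f G) < e" if "P F" "P G" for F G
    proof -
      have "dist (sum f F) (sum f T) \<le> e / 4" "dist (sum f G) (sum f T) \<le> e / 4"
        using close that by (auto simp: P_def dist_norm)
      then show ?thesis using dist_triangle2[of "sum f F" "sum f G" "sum f T"] \<open>0 < e\<close> by linarith
    qed
    ultimately show ?thesis by blast
  qed
  then have "cauchy_filter (filtermap (sum f) (finite_subsets_at_top I))"
    by (simp add: cauchy_filter_metric_filtermap)
  moreover have "complete (UNIV :: 'b set)"
    by (meson Cauchy_convergent UNIV_I complete_def convergent_def)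
  ultimately obtain L where "(sum f \<longlongrightarrow> L) (finite_subsets_at_top I)"
    using complete_uniform[where S = UNIV] by (force simp add: filterlim_def)
  then show ?thesis by (auto simp: summable_on_def has_sum_def)
qed

context hilbert_space
begin

section \<open>Inner products over a real or complex scalar field\<close>

lemma mult_scalar_conj_of_real: "(x::'k) * scalar_conj x = of_real ((norm x)\<^sup>2)"
  using mult_scalar_conj[of x] by (simp add: of_real_def)

lemma scalar_conj_zero: "scalar_conj (0::'k) = 0"
  using scalar_conj_add[of "0::'k" 0] by simp

lemma norm_scalar_conj: "norm (scalar_conj (x::'k)) = norm x"
proof (cases "x = 0")
  case False
  have "norm x * norm (scalar_conj x) = norm x * norm x"
    using arg_cong[OF mult_scalar_conj_of_real[of x], of norm]
    by (simp add: norm_mult power2_eq_square del: of_real_power)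
  with False show ?thesis by simp
qed (simp add: scalar_conj_zero)

lemma scalar_conj_of_real: "scalar_conj (of_real r :: 'k) = of_real r"
proof (cases "r = 0")
  case False
  have "of_real r * scalar_conj (of_real r :: 'k) = of_real r * of_real r"
    using mult_scalar_conj_of_real[of "of_real r :: 'k"] by (simp add: power2_eq_square)
  with False show ?thesis by simp
qed (simp add: scalar_conj_zero)

lemma ip_zero_left: "ip 0 x = 0"
  using ip_add_left[of 0 0 x] by simp

lemma ip_minus_left: "ip (- x) z = - ip x z"
  using ip_add_left[of x "- x" z] by (simp add: ip_zero_left add_eq_0_iff)

lemma ip_diff_left: "ip (x - y) z = ip x z - ip y z"
  using ip_add_left[of x "- y" z] by (simp add: ip_minus_left)

lemma ip_add_right: "ip z (x + y) = ip z x + ip z y"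
  by (metis ip_commute ip_add_left scalar_conj_add)

lemma ip_zero_right: "ip x 0 = 0"
  by (metis ip_commute ip_zero_left scalar_conj_zero)

lemma ip_minus_right: "ip z (- x) = - ip z x"
  using ip_add_right[of z x "- x"] by (simp add: ip_zero_right add_eq_0_iff)

lemma ip_diff_right: "ip z (x - y) = ip z x - ip z y"
  using ip_add_right[of z x "- y"] by (simp add: ip_minus_right)

lemma ip_smul_right: "ip x (smul c y) = scalar_conj c * ip x y"
  by (metis ip_commute ip_smul_left scalar_conj_mult)

lemma ip_sum_left: "ip (\<Sum>i\<in>F. f i) y = (\<Sum>i\<in>F. ip (f i) y)"
  by (induction F rule: infinite_finite_induct) (simp_all add: ip_zero_left ip_add_left)

lemma norm_ip_commute: "norm (ip x y) = norm (ip y x)"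
  by (metis ip_commute norm_scalar_conj)

text \<open>
  Subtracting from \<open>x\<close> its component along \<open>y\<close> lowers the squared norm by exactly this amount. That
  the result is nonnegative is the Cauchy--Schwarz inequality; that the decrease is strict unless
  \<open>\<langle>x, y\<rangle> = 0\<close> is why a shortest vector is an orthogonal one. For \<open>y = 0\<close> both quotients are \<open>0\<close>.
\<close>

lemma norm_minus_projection:
  "(norm (x - smul (ip x y / of_real ((norm y)\<^sup>2)) y))\<^sup>2
     = (norm x)\<^sup>2 - (norm (ip x y))\<^sup>2 / (norm y)\<^sup>2"
proof -
  define N where "N = (norm y)\<^sup>2"
  define z where "z = ip x y"
  define a where "a = 1 / N"
  define t where "t = of_real a * z"
  have z': "ip y x = scalar_conj z" unfolding z_def by (rule ip_commute)
  have ct: "scalar_conj t = of_real a * scalar_conj z"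
    unfolding t_def scalar_conj_mult scalar_conj_of_real ..
  have zz: "z * scalar_conj z = of_real ((norm z)\<^sup>2)" by (rule mult_scalar_conj_of_real)
  have "ip (x - smul t y) (x - smul t y)
      = ip x x - scalar_conj t * z - t * scalar_conj z + t * scalar_conj t * ip y y"
    by (simp only: ip_diff_left ip_diff_right ip_smul_left ip_smul_right z' flip: z_def)
      (simp add: algebra_simps)
  also have "\<dots> = of_real ((norm x)\<^sup>2) - 2 * of_real a * (z * scalar_conj z)
      + of_real a * of_real a * of_real N * (z * scalar_conj z)"
    unfolding ct ip_self N_def[symmetric] unfolding t_def by (simp add: algebra_simps)
  also have "\<dots> = of_real ((norm x)\<^sup>2 - 2 * a * (norm z)\<^sup>2 + a * a * N * (norm z)\<^sup>2)"
    unfolding zz by simp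
  also have "(norm x)\<^sup>2 - 2 * a * (norm z)\<^sup>2 + a * a * N * (norm z)\<^sup>2 = (norm x)\<^sup>2 - (norm z)\<^sup>2 / N"
    by (cases "N = 0") (simp_all add: a_def field_simps)
  finally have "(norm (x - smul t y))\<^sup>2 = (norm x)\<^sup>2 - (norm z)\<^sup>2 / N"
    unfolding ip_self of_real_eq_iff .
  moreover have "t = z / of_real N" by (simp add: t_def a_def)
  ultimately show ?thesis by (simp add: N_def z_def)
qed

lemma Cauchy_Schwarz: "norm (ip x y) \<le> norm x * norm y"
proof (cases "y = 0")
  case False
  have "0 \<le> (norm x)\<^sup>2 - (norm (ip x y))\<^sup>2 / (norm y)\<^sup>2"
    unfolding norm_minus_projection[symmetric] by simp
  with False have "(norm (ip x y))\<^sup>2 \<le> (norm x * norm y)\<^sup>2"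
    by (simp add: field_simps power_mult_distrib)
  then show ?thesis by (rule power2_le_imp_le) simp
qed (simp add: ip_zero_right)

lemma parallelogram_law:
  fixes x y :: 'a
  shows "(norm (x + y))\<^sup>2 + (norm (x - y))\<^sup>2 = 2 * (norm x)\<^sup>2 + 2 * (norm y)\<^sup>2"
proof -
  have "ip (x + y) (x + y) + ip (x - y) (x - y) = 2 * ip x x + 2 * ip y y"
    by (simp add: ip_add_left ip_add_right ip_diff_left ip_diff_right algebra_simps)
  then have "of_real ((norm (x + y))\<^sup>2 + (norm (x - y))\<^sup>2)
      = (of_real (2 * (norm x)\<^sup>2 + 2 * (norm y)\<^sup>2) :: 'k)"
    by (simp add: ip_self)
  then show ?thesis unfolding of_real_eq_iff .
qed

section \<open>Orthogonal projection\<close>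

text \<open>
  A sequence in \<open>M\<close> minimising the distance to \<open>y\<close> is Cauchy by the parallelogram law, and the
  minimality of its limit \<open>p\<close> forces \<open>y - p\<close> to be orthogonal to \<open>M\<close>.
\<close>

lemma orthogonal_projection:
  assumes M: "subspace M"
  shows "\<exists>p\<in>closure M. \<forall>m\<in>M. ip (y - p) m = 0"
proof -
  define D where "D = (\<lambda>m. (norm (y - m))\<^sup>2)"
  define d where "d = (INF m\<in>M. D m)"
  have bdd: "bdd_below (D ` M)" by (rule bdd_belowI[of _ 0]) (auto simp: D_def)
  have ne: "D ` M \<noteq> {}" using subspace_0[OF M] by auto
  have d_le: "d \<le> D m" if "m \<in> M" for m
    unfolding d_def using bdd that by (rule cINF_lower)
  have "\<exists>m\<in>M. D m < d + inverse (real (Suc n))" for n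
    using cInf_lessD[OF ne, of "d + inverse (real (Suc n))"] unfolding d_def by auto
  then obtain q where q: "\<And>n. q n \<in> M" "\<And>n. D (q n) < d + inverse (real (Suc n))"
    by metis
  have diff_bound: "(norm (q j - q k))\<^sup>2 \<le> 2 * inverse (real (Suc j)) + 2 * inverse (real (Suc k))" for j k
  proof -
    \<comment> \<open>The midpoint of two almost minimisers lies in \<open>M\<close>, so it cannot do better than \<open>d\<close>.\<close>
    have "smul (of_real (1/2)) (q j + q k) \<in> M"
      using M q by (intro subspace_scale subspace_add)
    then have "(1/2) *\<^sub>R (q j + q k) \<in> M" by (simp add: smul_of_real del: of_real_divide)
    from d_le[OF this] have "4 * d \<le> 4 * (norm (y - (1/2) *\<^sub>R (q j + q k)))\<^sup>2" by (simp add: D_def)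
    also have "\<dots> = (norm (2 *\<^sub>R (y - (1/2) *\<^sub>R (q j + q k))))\<^sup>2"
      by (simp add: power_mult_distrib)
    also have "2 *\<^sub>R (y - (1/2) *\<^sub>R (q j + q k)) = (y - q k) + (y - q j)"
      by (simp add: algebra_simps scaleR_2)
    finally have "4 * d \<le> (norm ((y - q k) + (y - q j)))\<^sup>2" .
    moreover have "(norm ((y - q k) + (y - q j)))\<^sup>2 + (norm (q j - q k))\<^sup>2 = 2 * D (q k) + 2 * D (q j)"
      using parallelogram_law[of "y - q k" "y - q j"] by (simp add: D_def)
    ultimately show ?thesis using q(2)[of j] q(2)[of k] by linarith
  qed
  have "Cauchy q"
  proof (rule metric_CauchyI)
    fix e :: real assume "0 < e"
    then obtain N where N: "inverse (real (Suc N)) < e\<^sup>2 / 4"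
      using reals_Archimedean[of "e\<^sup>2 / 4"] by auto
    have "dist (q j) (q k) < e" if "N \<le> j" "N \<le> k" for j k
    proof -
      have "inverse (real (Suc j)) \<le> inverse (real (Suc N))" "inverse (real (Suc k)) \<le> inverse (real (Suc N))"
        using that by (simp_all add: le_imp_inverse_le)
      with diff_bound[of j k] N have "(norm (q j - q k))\<^sup>2 < e\<^sup>2" by linarith
      then show ?thesis using \<open>0 < e\<close> by (simp add: dist_norm power2_less_imp_less)
    qed
    then show "\<exists>N. \<forall>j\<ge>N. \<forall>k\<ge>N. dist (q j) (q k) < e" by blast
  qed
  then obtain p where p: "q \<longlonglongrightarrow> p" using Cauchy_convergent_iff convergent_def by blast
  have upper: "D p \<le> d"
  proof (rule LIMSEQ_le)
    show "(\<lambda>n. D (q n)) \<longlonglongrightarrow> D p" unfolding D_def by (intro tendsto_intros p)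
    show "(\<lambda>n. d + inverse (real (Suc n))) \<longlonglongrightarrow> d"
      using LIMSEQ_inverse_real_of_nat_add[of d] by simp
    show "\<exists>N. \<forall>n\<ge>N. D (q n) \<le> d + inverse (real (Suc n))" using q(2) less_imp_le by blast
  qed
  have lower: "d \<le> D (p + s)" if "s \<in> M" for s
  proof (rule LIMSEQ_le_const)
    show "(\<lambda>n. D (q n + s)) \<longlonglongrightarrow> D (p + s)" unfolding D_def by (intro tendsto_intros p)
    show "\<exists>N. \<forall>n\<ge>N. d \<le> D (q n + s)" using d_le subspace_add[OF M q(1) that] by blast
  qed
  show ?thesis
  proof (intro bexI ballI)
    show "p \<in> closure M" using p q(1) by (auto simp: closure_sequential)
    fix m assume m: "m \<in> M"
    define t where "t = ip (y - p) m / of_real ((norm m)\<^sup>2)"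
    have "D p \<le> D (p + smul t m)" using upper lower[OF subspace_scale[OF M m, of t]] by linarith
    also have "\<dots> = (norm ((y - p) - smul t m))\<^sup>2" by (simp add: D_def diff_diff_eq)
    also have "\<dots> = D p - (norm (ip (y - p) m))\<^sup>2 / (norm m)\<^sup>2"
      unfolding t_def norm_minus_projection by (simp add: D_def)
    finally have "(norm (ip (y - p) m))\<^sup>2 / (norm m)\<^sup>2 \<le> 0" by simp
    then have "ip (y - p) m = 0 \<or> m = 0"
      by (auto simp: divide_le_0_iff)
    then show "ip (y - p) m = 0" by (auto simp: ip_zero_right)
  qed
qed

section \<open>Frames and finite sums\<close>

lemma frame_orthogonal_eq_zero:
  assumes "frame_bounds ip I f A B" and "\<And>i. i \<in> I \<Longrightarrow> ip x (f i) = 0"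
  shows "x = 0"
proof -
  have "(\<Sum>\<^sub>\<infinity>i\<in>I. (norm (ip x (f i)))\<^sup>2) = 0" by (rule infsum_0) (simp add: assms(2))
  moreover have "0 < A" "A * (norm x)\<^sup>2 \<le> (\<Sum>\<^sub>\<infinity>i\<in>I. (norm (ip x (f i)))\<^sup>2)"
    using assms(1) unfolding frame_bounds_def by auto
  ultimately show ?thesis by (simp add: mult_le_0_iff)
qed

lemma frame_complete:
  assumes "frame_bounds ip I f A B"
  shows "closure (span (f ` I)) = UNIV"
proof -
  have "y \<in> closure (span (f ` I))" for y
  proof -
    obtain p where p: "p \<in> closure (span (f ` I))" "\<And>m. m \<in> span (f ` I) \<Longrightarrow> ip (y - p) m = 0"
      using orthogonal_projection[OF subspace_span] by blast
    have "y - p = 0"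
      by (rule frame_orthogonal_eq_zero[OF assms]) (simp add: p(2) span_base)
    with p(1) show ?thesis by simp
  qed
  then show ?thesis by blast
qed

text \<open>
  For \<open>y = \<Sum> c\<^sub>i f\<^sub>i\<close> write \<open>\<parallel>y\<parallel>\<^sup>2 = \<Sum> c\<^sub>i \<langle>f\<^sub>i, y\<rangle>\<close> and apply the Cauchy--Schwarz inequality for finite
  sums; the frame inequality bounds the second factor by \<open>\<surd>B \<parallel>y\<parallel>\<close>.
\<close>

lemma frame_synthesis_upper:
  assumes fr: "frame_bounds ip I f A B" and F: "finite F" "F \<subseteq> I"
  shows "(norm (\<Sum>i\<in>F. smul (c i) (f i)))\<^sup>2 \<le> B * (\<Sum>i\<in>F. (norm (c i))\<^sup>2)"
proof -
  define y where "y = (\<Sum>i\<in>F. smul (c i) (f i))"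
  define s where "s = (\<Sum>i\<in>F. (norm (c i))\<^sup>2)"
  define r where "r = (\<Sum>i\<in>F. (norm (ip y (f i)))\<^sup>2)"
  have "0 < B" using fr unfolding frame_bounds_def by linarith
  have "r \<le> (\<Sum>\<^sub>\<infinity>i\<in>I. (norm (ip y (f i)))\<^sup>2)"
    unfolding r_def using fr F by (intro finite_sum_le_infsum) (auto simp: frame_bounds_def)
  then have r: "r \<le> B * (norm y)\<^sup>2" using fr unfolding frame_bounds_def by (meson order_trans)
  have "of_real ((norm y)\<^sup>2) = (\<Sum>i\<in>F. c i * ip (f i) y)"
    using ip_self[of y] ip_sum_left[of "\<lambda>i. smul (c i) (f i)" F y]
    by (simp add: ip_smul_left flip: y_def)
  then have "(norm y)\<^sup>2 = norm (\<Sum>i\<in>F. c i * ip (f i) y)"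
    by (metis abs_of_nonneg norm_of_real zero_le_power2)
  also have "\<dots> \<le> (\<Sum>i\<in>F. \<bar>norm (c i)\<bar> * \<bar>norm (ip y (f i))\<bar>)"
    by (rule sum_norm_le) (simp add: norm_mult norm_ip_commute)
  also have "\<dots> \<le> sqrt s * sqrt r"
    using L2_set_mult_ineq[of "\<lambda>i. norm (c i)" "\<lambda>i. norm (ip y (f i))" F]
    by (simp add: L2_set_def s_def r_def)
  finally have "((norm y)\<^sup>2)\<^sup>2 \<le> (sqrt s * sqrt r)\<^sup>2" by (rule power_mono) simp
  also have "\<dots> = s * r" by (simp add: power_mult_distrib s_def r_def sum_nonneg)
  also have "\<dots> \<le> s * (B * (norm y)\<^sup>2)"
    using r by (rule mult_left_mono) (simp add: s_def sum_nonneg)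
  finally have "(norm y)\<^sup>2 * (norm y)\<^sup>2 \<le> (B * s) * (norm y)\<^sup>2"
    by (simp add: power2_eq_square algebra_simps)
  then have "(norm y)\<^sup>2 \<le> B * s \<or> y = 0"
    by (auto simp only: mult_le_cancel_right zero_less_power2 norm_eq_zero not_less)
  moreover have "0 \<le> B * s" using \<open>0 < B\<close> by (simp add: s_def sum_nonneg)
  ultimately show ?thesis unfolding y_def s_def by auto
qed

definition biorthogonal :: "'i set \<Rightarrow> ('i \<Rightarrow> 'a) \<Rightarrow> ('i \<Rightarrow> 'a) \<Rightarrow> bool" where
  "biorthogonal I u f \<longleftrightarrow> (\<forall>i\<in>I. \<forall>j\<in>I. ip (u j) (f i) = (if i = j then 1 else 0))"

text \<open>
  The dual system provides a vector \<open>x = \<Sum> c\<^sub>j u\<^sub>j\<close> whose frame coefficients are the \<open>c\<^sub>i\<close>. Pairing it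
  with \<open>y = \<Sum> c\<^sub>i f\<^sub>i\<close> gives \<open>\<Sum> |c\<^sub>i|\<^sup>2 \<le> \<parallel>y\<parallel> \<parallel>x\<parallel>\<close>, and the frame inequality for \<open>x\<close> reads
  \<open>A \<parallel>x\<parallel>\<^sup>2 \<le> \<Sum> |c\<^sub>i|\<^sup>2\<close>.
\<close>

lemma frame_synthesis_lower:
  assumes fr: "frame_bounds ip I f A B" and F: "finite F" "F \<subseteq> I"
    and dual: "biorthogonal I u f"
  shows "A * (\<Sum>i\<in>F. (norm (c i))\<^sup>2) \<le> (norm (\<Sum>i\<in>F. smul (c i) (f i)))\<^sup>2"
proof -
  define y where "y = (\<Sum>i\<in>F. smul (c i) (f i))"
  define x where "x = (\<Sum>j\<in>F. smul (c j) (u j))"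
  define s where "s = (\<Sum>i\<in>F. (norm (c i))\<^sup>2)"
  have s0: "0 \<le> s" by (simp add: s_def sum_nonneg)
  have coeff: "ip x (f i) = (if i \<in> F then c i else 0)" if "i \<in> I" for i
  proof -
    have "ip x (f i) = (\<Sum>j\<in>F. if i = j then c j else 0)"
      unfolding x_def ip_sum_left ip_smul_left using dual F that
      by (intro sum.cong) (auto simp: biorthogonal_def)
    then show ?thesis using F by simp
  qed
  have "((\<lambda>i. (norm (ip x (f i)))\<^sup>2) has_sum s) I"
    unfolding s_def using F by (intro has_sum_finite_neutralI[OF F]) (auto simp: coeff intro!: sum.cong)
  then have x_bound: "A * (norm x)\<^sup>2 \<le> s"
    using fr infsumI unfolding frame_bounds_def by metis
  have "ip y x = (\<Sum>i\<in>F. c i * scalar_conj (ip x (f i)))"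
    unfolding y_def ip_sum_left ip_smul_left by (rule sum.cong) (simp_all flip: ip_commute)
  also have "\<dots> = (\<Sum>i\<in>F. of_real ((norm (c i))\<^sup>2))"
    using F by (intro sum.cong) (auto simp: coeff subset_iff mult_scalar_conj_of_real)
  also have "\<dots> = of_real s" by (simp add: s_def)
  finally have "s \<le> norm y * norm x"
    using Cauchy_Schwarz[of y x] s0 by simp
  then have "s\<^sup>2 \<le> (norm y * norm x)\<^sup>2" using s0 by (rule power_mono)
  moreover have "0 < A" using fr by (simp add: frame_bounds_def)
  ultimately have "A * s\<^sup>2 \<le> (norm y)\<^sup>2 * (A * (norm x)\<^sup>2)"
    by (simp add: power_mult_distrib mult.left_commute)
  also have "\<dots> \<le> (norm y)\<^sup>2 * s" using x_bound by (rule mult_left_mono) simp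
  finally have "(A * s) * s \<le> (norm y)\<^sup>2 * s" by (simp add: power2_eq_square mult.assoc)
  then have "A * s \<le> (norm y)\<^sup>2"
    using s0 by (cases "s = 0") (simp_all add: mult_le_cancel_right)
  then show ?thesis by (simp add: y_def s_def)
qed

section \<open>Riesz sequences\<close>

lemma riesz_sequence_boundsI_finite:
  assumes "0 < A" "A \<le> B"
    and lower: "\<And>F c. finite F \<Longrightarrow> F \<subseteq> I \<Longrightarrow>
      A * (\<Sum>i\<in>F. (norm (c i))\<^sup>2) \<le> (norm (\<Sum>i\<in>F. smul (c i) (f i)))\<^sup>2"
    and upper: "\<And>F c. finite F \<Longrightarrow> F \<subseteq> I \<Longrightarrow>
      (norm (\<Sum>i\<in>F. smul (c i) (f i)))\<^sup>2 \<le> B * (\<Sum>i\<in>F. (norm (c i))\<^sup>2)"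
  shows "riesz_sequence_bounds smul I f A B"
  unfolding riesz_sequence_bounds_def
proof (intro conjI allI impI)
  fix c :: "'b \<Rightarrow> 'k" assume c: "(\<lambda>i. (norm (c i))\<^sup>2) summable_on I"
  show sf: "(\<lambda>i. smul (c i) (f i)) summable_on I"
    using assms by (intro summable_on_of_square_bound[OF c _ upper]) auto
  note lim_c = infsum_tendsto[OF c] and lim_f = infsum_tendsto[OF sf]
  have ev: "\<forall>\<^sub>F F in finite_subsets_at_top I. finite F \<and> F \<subseteq> I"
    by (auto simp: eventually_finite_subsets_at_top)
  show "A * (\<Sum>\<^sub>\<infinity>i\<in>I. (norm (c i))\<^sup>2) \<le> (norm (\<Sum>\<^sub>\<infinity>i\<in>I. smul (c i) (f i)))\<^sup>2"
    by (rule tendsto_le[OF finite_subsets_at_top_neq_bot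
          tendsto_power[OF tendsto_norm[OF lim_f]] tendsto_mult[OF tendsto_const lim_c] eventually_mono[OF ev]])
      (simp add: lower)
  show "(norm (\<Sum>\<^sub>\<infinity>i\<in>I. smul (c i) (f i)))\<^sup>2 \<le> B * (\<Sum>\<^sub>\<infinity>i\<in>I. (norm (c i))\<^sup>2)"
    by (rule tendsto_le[OF finite_subsets_at_top_neq_bot
          tendsto_mult[OF tendsto_const lim_c] tendsto_power[OF tendsto_norm[OF lim_f]] eventually_mono[OF ev]])
      (simp add: upper)
qed (use \<open>0 < A\<close> \<open>A \<le> B\<close> in auto)

lemma riesz_sequence_finite_lower:
  assumes "riesz_sequence_bounds smul I f A B" and F: "finite F" "F \<subseteq> I"
  shows "A * (\<Sum>i\<in>F. (norm (c i))\<^sup>2) \<le> (norm (\<Sum>i\<in>F. smul (c i) (f i)))\<^sup>2"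
proof -
  define c' where "c' i = (if i \<in> F then c i else 0)" for i
  have 1: "((\<lambda>i. (norm (c' i))\<^sup>2) has_sum (\<Sum>i\<in>F. (norm (c i))\<^sup>2)) I"
    by (rule has_sum_finite_neutralI[OF F]) (auto simp: c'_def)
  have 2: "((\<lambda>i. smul (c' i) (f i)) has_sum (\<Sum>i\<in>F. smul (c i) (f i))) I"
    by (rule has_sum_finite_neutralI[OF F]) (auto simp: c'_def)
  from 1 have "(\<lambda>i. (norm (c' i))\<^sup>2) summable_on I" by (rule has_sum_imp_summable)
  with assms(1) have "A * (\<Sum>\<^sub>\<infinity>i\<in>I. (norm (c' i))\<^sup>2) \<le> (norm (\<Sum>\<^sub>\<infinity>i\<in>I. smul (c' i) (f i)))\<^sup>2"
    unfolding riesz_sequence_bounds_def by blast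
  then show ?thesis unfolding infsumI[OF 1] infsumI[OF 2] .
qed

text \<open>
  A finite combination of the other vectors minus \<open>f\<^sub>k\<close> has coefficient \<open>-1\<close> at \<open>k\<close>, so by the lower
  Riesz bound its norm is at least \<open>\<surd>A\<close>.
\<close>

lemma riesz_sequence_minimal:
  assumes R: "riesz_sequence_bounds smul I f A B" and k: "k \<in> I"
  shows "f k \<notin> closure (span (f ` (I - {k})))"
proof
  have "0 < A" using R by (simp add: riesz_sequence_bounds_def)
  have combination: "\<exists>T c. finite T \<and> T \<subseteq> I - {k} \<and> m = (\<Sum>i\<in>T. smul (c i) (f i))"
    if "m \<in> span (f ` (I - {k}))" for m
    using that
  proof (induction rule: span_induct_alt)
    case base
    show ?case by (intro exI[of _ "{}"]) simp
  next
    case (step a x y)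
    then obtain j T c where j: "j \<in> I - {k}" "x = f j"
      and T: "finite T" "T \<subseteq> I - {k}" "y = (\<Sum>i\<in>T. smul (c i) (f i))" by blast
    \<comment> \<open>The index \<open>j\<close> may already occur in \<open>T\<close>, in which case the two coefficients add up.\<close>
    define c' where "c' i = (if i = j then a else 0) + (if i \<in> T then c i else 0)" for i
    have "(\<Sum>i\<in>insert j T. smul (c' i) (f i))
        = (\<Sum>i\<in>insert j T. smul (if i = j then a else 0) (f i))
          + (\<Sum>i\<in>insert j T. smul (if i \<in> T then c i else 0) (f i))"
      unfolding c'_def scale_left_distrib sum.distrib ..
    also have "(\<Sum>i\<in>insert j T. smul (if i = j then a else 0) (f i)) = smul a x"
      using T by (subst sum.mono_neutral_right[of _ "{j}"]) (auto simp: j)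
    also have "(\<Sum>i\<in>insert j T. smul (if i \<in> T then c i else 0) (f i)) = y"
      using T by (subst sum.mono_neutral_right[of _ T]) auto
    finally show ?case using j T by (intro exI[of _ "insert j T"] exI[of _ c']) auto
  qed
  have far: "A \<le> (norm (m - f k))\<^sup>2" if m: "m \<in> span (f ` (I - {k}))" for m
  proof -
    obtain T c where T: "finite T" "T \<subseteq> I - {k}" "m = (\<Sum>i\<in>T. smul (c i) (f i))"
      using combination[OF m] by blast
    define c' where "c' = c(k := - 1)"
    have kT: "k \<notin> T" using T by auto
    have "(\<Sum>i\<in>insert k T. smul (c' i) (f i)) = m - f k"
      using T kT by (auto simp: c'_def intro!: sum.cong)
    moreover have "A * 1 \<le> A * (\<Sum>i\<in>insert k T. (norm (c' i))\<^sup>2)"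
      using T kT \<open>0 < A\<close> by (intro mult_left_mono) (simp_all add: c'_def sum_nonneg)
    moreover have "A * (\<Sum>i\<in>insert k T. (norm (c' i))\<^sup>2) \<le> (norm (\<Sum>i\<in>insert k T. smul (c' i) (f i)))\<^sup>2"
      using T k by (intro riesz_sequence_finite_lower[OF R]) auto
    ultimately show ?thesis by simp
  qed
  assume "f k \<in> closure (span (f ` (I - {k})))"
  then obtain m where m: "m \<in> span (f ` (I - {k}))" "dist m (f k) < sqrt A"
    using \<open>0 < A\<close> by (meson closure_approachable real_sqrt_gt_zero)
  then have "(norm (m - f k))\<^sup>2 < A"
    using \<open>0 < A\<close> power_strict_mono[of "norm (m - f k)" "sqrt A" 2] by (simp add: dist_norm)
  with far[OF m(1)] show False by simp
qed

section \<open>Dual systems and their exchange\<close>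

text \<open>
  The part of \<open>f\<^sub>k\<close> orthogonal to the other vectors has a nonzero inner product with \<open>f\<^sub>k\<close>: otherwise
  it would be orthogonal to the whole frame, hence zero, and \<open>f\<^sub>k\<close> would lie in the closed span of
  the others.
\<close>

lemma minimal_frame_has_dual:
  assumes fr: "frame_bounds ip I f A B"
    and minimal: "\<And>k. k \<in> I \<Longrightarrow> f k \<notin> closure (span (f ` (I - {k})))"
  shows "\<exists>u. biorthogonal I u f"
proof -
  have "\<exists>w. \<forall>i\<in>I. ip w (f i) = (if i = k then 1 else 0)" if k: "k \<in> I" for k
  proof -
    obtain p where p: "p \<in> closure (span (f ` (I - {k})))"
        "\<And>m. m \<in> span (f ` (I - {k})) \<Longrightarrow> ip (f k - p) m = 0"
      using orthogonal_projection[OF subspace_span] by blast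
    have others: "ip (f k - p) (f i) = 0" if "i \<in> I" "i \<noteq> k" for i
      using that by (intro p(2) span_base) auto
    have "ip (f k - p) (f k) \<noteq> 0"
    proof
      assume "ip (f k - p) (f k) = 0"
      with others have "f k - p = 0" by (intro frame_orthogonal_eq_zero[OF fr]) metis
      with p(1) minimal[OF k] show False by simp
    qed
    then have "\<forall>i\<in>I. ip (smul (inverse (ip (f k - p) (f k))) (f k - p)) (f i) = (if i = k then 1 else 0)"
      by (simp add: ip_smul_left others)
    then show ?thesis by blast
  qed
  then show ?thesis unfolding biorthogonal_def by metis
qed

text \<open>
  If \<open>\<langle>u\<^sub>k, v\<rangle>\<close> vanished, \<open>u\<^sub>k\<close> would be orthogonal to the whole new frame, hence zero, which
  \<open>\<langle>u\<^sub>k, f\<^sub>k\<rangle> = 1\<close> excludes. So \<open>u\<^sub>k\<close> can be rescaled to pair to \<open>1\<close> with \<open>v\<close>, and subtracting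
  multiples of it makes the other \<open>u\<^sub>j\<close> orthogonal to \<open>v\<close> without changing their products with the
  remaining \<open>f\<^sub>i\<close>.
\<close>

lemma biorthogonal_exchange:
  assumes "biorthogonal I u f"
    and fr: "frame_bounds ip I (f(k := v)) A B" and k: "k \<in> I"
  shows "\<exists>u'. biorthogonal I u' (f(k := v))"
proof -
  have dual: "ip (u j) (f i) = (if i = j then 1 else 0)" if "i \<in> I" "j \<in> I" for i j
    using assms(1) that by (simp add: biorthogonal_def)
  have nz: "ip (u k) v \<noteq> 0"
  proof
    assume "ip (u k) v = 0"
    then have "u k = 0"
      using dual k by (intro frame_orthogonal_eq_zero[OF fr]) auto
    with dual k show False by (force simp: ip_zero_left)
  qed
  define w where "w = smul (inverse (ip (u k) v)) (u k)"
  define u' where "u' j = (if j = k then w else u j - smul (ip (u j) v) w)" for j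
  have w: "ip w v = 1" "\<And>i. i \<in> I \<Longrightarrow> i \<noteq> k \<Longrightarrow> ip w (f i) = 0"
    using nz dual k by (auto simp: w_def ip_smul_left)
  have "ip (u' j) ((f(k := v)) i) = (if i = j then 1 else 0)" if "i \<in> I" "j \<in> I" for i j
    using that dual by (auto simp: u'_def w ip_diff_left ip_smul_left)
  then show ?thesis unfolding biorthogonal_def by blast
qed

lemma finite_weaving_has_dual:
  assumes weave: "\<And>F. finite F \<Longrightarrow> F \<subseteq> I \<Longrightarrow> frame_bounds ip I (\<lambda>i. if i \<in> F then \<psi> i else \<phi> i) A B"
    and dual: "biorthogonal I u \<phi>"
    and F: "finite F" "F \<subseteq> I"
  shows "\<exists>v. biorthogonal I v (\<lambda>i. if i \<in> F then \<psi> i else \<phi> i)"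
  using F
proof (induction F)
  case empty
  with dual show ?case by auto
next
  case (insert k F)
  define h where "h = (\<lambda>i. if i \<in> F then \<psi> i else \<phi> i)"
  have eq: "(\<lambda>i. if i \<in> insert k F then \<psi> i else \<phi> i) = h(k := \<psi> k)"
    by (auto simp: h_def)
  obtain v where v: "biorthogonal I v h"
    using insert by (auto simp: h_def)
  have fr: "frame_bounds ip I (h(k := \<psi> k)) A B"
    using weave[of "insert k F"] insert.hyps insert.prems unfolding eq by simp
  show ?case
    unfolding eq using biorthogonal_exchange[OF v fr] insert.prems by simp
qed

end

section \<open>Frames woven with a Riesz basis\<close>

theorem theorem5p4:
  fixes smul :: "'k::real_or_complex \<Rightarrow> 'a::banach \<Rightarrow> 'a"
    and ip :: "'a \<Rightarrow> 'a \<Rightarrow> 'k"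
    and \<phi> \<psi> :: "nat \<Rightarrow> 'a"
  assumes "hilbert_space smul ip"
    and "riesz_basis smul UNIV \<phi>"
    and "is_frame ip UNIV \<psi>"
    and "woven ip \<phi> \<psi>"
  shows "riesz_basis smul UNIV \<psi>"
proof -
  interpret hilbert_space smul ip by fact
  obtain A B where AB: "0 < A" "A \<le> B"
    and weave: "\<And>\<sigma>. frame_bounds ip UNIV (\<lambda>i. if i \<in> \<sigma> then \<phi> i else \<psi> i) A B"
    using assms(4) unfolding woven_def by blast
  have frame_weave: "frame_bounds ip UNIV (\<lambda>i. if i \<in> F then \<psi> i else \<phi> i) A B" for F
  proof -
    have "(\<lambda>i. if i \<in> F then \<psi> i else \<phi> i) = (\<lambda>i. if i \<in> - F then \<phi> i else \<psi> i)" by auto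
    then show ?thesis using weave[of "- F"] by simp
  qed
  have frame_phi: "frame_bounds ip UNIV \<phi> A B" and frame_psi: "frame_bounds ip UNIV \<psi> A B"
    using weave[of UNIV] weave[of "{}"] by simp_all
  obtain A' B' where "riesz_sequence_bounds smul UNIV \<phi> A' B'"
    using assms(2) unfolding riesz_basis_def riesz_sequence_def by blast
  note minimal = riesz_sequence_minimal[OF this]
  obtain u where u: "biorthogonal UNIV u \<phi>"
    using minimal_frame_has_dual[OF frame_phi minimal] ..
  have "riesz_sequence_bounds smul UNIV \<psi> A B"
  proof (rule riesz_sequence_boundsI_finite[OF AB])
    fix F :: "nat set" and c :: "nat \<Rightarrow> 'k" assume F: "finite F" "F \<subseteq> UNIV"
    show "(norm (\<Sum>i\<in>F. smul (c i) (\<psi> i)))\<^sup>2 \<le> B * (\<Sum>i\<in>F. (norm (c i))\<^sup>2)"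
      by (rule frame_synthesis_upper[OF frame_psi F])
    obtain v where v: "biorthogonal UNIV v (\<lambda>i. if i \<in> F then \<psi> i else \<phi> i)"
      using finite_weaving_has_dual[OF frame_weave u F] ..
    have "A * (\<Sum>i\<in>F. (norm (c i))\<^sup>2) \<le> (norm (\<Sum>i\<in>F. smul (c i) (if i \<in> F then \<psi> i else \<phi> i)))\<^sup>2"
      by (rule frame_synthesis_lower[OF frame_weave F v])
    then show "A * (\<Sum>i\<in>F. (norm (c i))\<^sup>2) \<le> (norm (\<Sum>i\<in>F. smul (c i) (\<psi> i)))\<^sup>2"
      by simp
  qed
  then show ?thesis
    using frame_complete[OF frame_psi] unfolding riesz_basis_def riesz_sequence_def by blast
qed

end
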